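(* For every integer $r\geq2$, the set of $s\in\mathbb N$ with $s\equiv9\pmod{12}$ and $\ell(s)=r$ is the union of exactly $F_{r-1}$ residue classes modulo $12\cdot2^r$. For every integer $r\geq3$, the set of $s\in\mathbb N$ with ($s\equiv3\pmod{12}$ or $s\equiv7\pmod{12}$) and $\ell(s)=r$ is the union of exactly $2F_r-2$ residue classes modulo $12\cdot2^r$.
   Context: $\mathbb N$ denotes the positive integers. The Collatz function $T:\mathbb N\to\mathbb N$ is $T(n)=n/2$ if $n$ is even and $T(n)=(3n+1)/2$ if $n$ is odd; $T^0(s)=s$ and $T^k(s)=T(T^{k-1}(s))$ for $k\geq1$. For odd $s\in\mathbb N$, the cut time is $$\ell(s)=\min\{k\geq1 : T^k(s)\equiv 3\pmod 4 \text{ and } T^{k-1}(s)\text{ is even}\},$$ with $\ell(s)=\infty$ if this set is empty. A residue class modulo $m$ means a set $[a]_m=\{n\in\mathbb N: n\equiv a\pmod m\}$. The Fibonacci numbers are $F_0=0$, $F_1=1$, $F_{m+1}=F_m+F_{m-1}$ for $m\geq1$. *)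

theory Defs
  imports "HOL-Number_Theory.Number_Theory" "HOL-Library.Extended_Nat"
begin

(* The paper works with the positive integers. Here the type is nat; T maps positive
   numbers to positive numbers, and the sets below are restricted to positive elements. *)

definition collatz :: "nat \<Rightarrow> nat" where
  "collatz n = (if even n then n div 2 else (3 * n + 1) div 2)"

definition cut_times :: "nat \<Rightarrow> nat set" where
  "cut_times s = {k. 1 \<le> k \<and> [(collatz ^^ k) s = 3] (mod 4) \<and> even ((collatz ^^ (k - 1)) s)}"

(* Only meaningful for odd positive s. *)
definition cut_time :: "nat \<Rightarrow> enat" where
  "cut_time s = (if cut_times s = {} then \<infinity> else enat (LEAST k. k \<in> cut_times s))"

definition residue_class :: "nat \<Rightarrow> nat \<Rightarrow> nat set" where
  "residue_class a m = {n. 0 < n \<and> [n = a] (mod m)}"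

(* Distinct classes modulo the same m are disjoint and nonempty, so N is determined by S and m. *)
definition union_of_residue_classes :: "nat set \<Rightarrow> nat \<Rightarrow> nat \<Rightarrow> bool" where
  "union_of_residue_classes S N m \<longleftrightarrow>
     (\<exists>C. finite C \<and> card C = N \<and> (\<forall>c\<in>C. \<exists>a. c = residue_class a m) \<and> S = \<Union>C)"

end

theory Submission
  imports Defs
begin

text \<open>
  For odd \<open>n\<close>, one has \<open>n \<equiv> 3 (mod 4)\<close> iff \<open>T n\<close> is odd as well. Hence \<open>\<ell>(s) = r\<close> says that in
  the sequence of parities of \<open>s, T s, T\<^sup>2 s, \<dots>\<close> (even = 0, odd = 1) the pattern 011 occurs for the
  first time at positions \<open>r - 1, r, r + 1\<close>. By Terras' theorem the first \<open>r + 2\<close> parities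
  correspond bijectively to the residue of \<open>s\<close> modulo \<open>2\<^sup>r\<^sup>+\<^sup>2\<close>, so by the Chinese remainder theorem
  it only remains to count the binary words of length \<open>r + 2\<close> that start with 10 (for
  \<open>s \<equiv> 1 (mod 4)\<close>) or 11 (for \<open>s \<equiv> 3 (mod 4)\<close>) and contain 011 exactly once, at the end. The
  counts satisfy Fibonacci-type recurrences.
\<close>

section \<open>Parity words and residues\<close>

primrec parity_word :: "nat \<Rightarrow> nat \<Rightarrow> bool list" where
  "parity_word 0 s = []"
| "parity_word (Suc n) s = odd s # parity_word n (collatz s)"

lemma length_parity_word [simp]: "length (parity_word n s) = n"
  by (induction n arbitrary: s) auto

lemma two_collatz: "2 * collatz s = (if even s then s else 3 * s + 1)"
  by (auto simp: collatz_def)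

text \<open>For equal parities, doubling turns \<open>collatz\<close> into \<open>s\<close> or
  \<open>3 * s + 1\<close>, and 3 is invertible modulo \<open>2 * m\<close>. This is the induction
  step of Terras' theorem.\<close>

lemma cong_double_modulus_iff:
  fixes s t m :: nat
  assumes "coprime 3 m"
  shows "[s = t] (mod 2 * m) \<longleftrightarrow> even s = even t \<and> [collatz s = collatz t] (mod m)"
proof (cases "even s = even t")
  case True
  have "[collatz s = collatz t] (mod m) \<longleftrightarrow> [2 * collatz s = 2 * collatz t] (mod 2 * m)"
    by (simp add: cong_def mult_mod_right [symmetric])
  also have "\<dots> \<longleftrightarrow> [s = t] (mod 2 * m)"
  proof (cases "even s")
    case odd: False
    have "coprime 3 (2 * m)" using assms by simp
    then have "[3 * s = 3 * t] (mod 2 * m) \<longleftrightarrow> [s = t] (mod 2 * m)"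
      by (rule cong_mult_lcancel_nat)
    then show ?thesis
      using odd True by (simp only: two_collatz if_False cong_add_rcancel_nat)
  qed (use True in \<open>simp add: two_collatz\<close>)
  finally show ?thesis using True by simp
next
  case False
  then show ?thesis
    using cong_dvd_iff cong_dvd_modulus_nat dvd_triv_left by blast
qed

lemma parity_word_eq_iff:
  "parity_word n s = parity_word n t \<longleftrightarrow> [s = t] (mod 2 ^ n)"
proof (induction n arbitrary: s t)
  case (Suc n)
  then show ?case by (simp add: cong_double_modulus_iff)
qed auto

text \<open>Injectivity is Terras' theorem plus the Chinese remainder theorem; surjectivity follows
  since both sides have \<open>3 * 2 ^ n\<close> elements.\<close>

lemma bij_betw_parity_word_mod_3:
  "bij_betw (\<lambda>a. (parity_word n a, a mod 3)) {..<3 * 2 ^ n}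
     ({w. length w = n} \<times> {..<3})"
proof -
  let ?f = "\<lambda>a. (parity_word n a, a mod 3)"
  have lists: "finite {w :: bool list. length w = n}" "card {w :: bool list. length w = n} = 2 ^ n"
    using finite_lists_length_eq [of "UNIV :: bool set" n] card_lists_length_eq [of "UNIV :: bool set" n]
    by auto
  have inj: "inj_on ?f {..<3 * 2 ^ n}"
  proof (rule inj_onI)
    fix a b :: nat
    assume ab: "a \<in> {..<3 * 2 ^ n}" "b \<in> {..<3 * 2 ^ n}" and eq: "?f a = ?f b"
    have "[a = b] (mod 2 ^ n)" "[a = b] (mod 3)"
      using eq by (auto simp: parity_word_eq_iff cong_def)
    moreover have "coprime (3 :: nat) (2 ^ n)" by simp
    ultimately have "[a = b] (mod 3 * 2 ^ n)"
      by (simp add: coprime_cong_mult_nat)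
    then show "a = b" using ab by (simp add: cong_def)
  qed
  have "?f ` {..<3 * 2 ^ n} = {w. length w = n} \<times> {..<3}"
    by (rule card_subset_eq) (use lists inj in \<open>auto simp: card_image card_cartesian_product\<close>)
  with inj show ?thesis by (simp add: bij_betw_def)
qed

lemma residue_class_eq_iff:
  assumes "0 < m"
  shows "residue_class a m = residue_class b m \<longleftrightarrow> [a = b] (mod m)"
proof
  assume "residue_class a m = residue_class b m"
  \<comment> \<open>\<open>a\<close> itself may be 0, which lies in no class; \<open>a + m\<close>
    is always positive.\<close>
  moreover have "a + m \<in> residue_class a m"
    using assms by (simp add: residue_class_def cong_def)
  ultimately have "[a + m = b] (mod m)" by (simp add: residue_class_def)
  then show "[a = b] (mod m)" by (simp add: cong_def)
qed (auto simp: residue_class_def cong_def)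

lemma union_of_residue_classes_parity_words:
  assumes W: "W \<subseteq> {w. length w = n}" and R: "R \<subseteq> {..<3}"
  shows "union_of_residue_classes {s. 0 < s \<and> parity_word n s \<in> W \<and> s mod 3 \<in> R}
           (card W * card R) (3 * 2 ^ n)"
proof -
  let ?m = "3 * 2 ^ n :: nat"
  let ?f = "\<lambda>a. (parity_word n a, a mod 3)"
  define A where "A = {a. a < ?m \<and> ?f a \<in> W \<times> R}"
  let ?C = "(\<lambda>a. residue_class a ?m) ` A"
  have fin: "finite A" by (simp add: A_def)
  have "bij_betw ?f A (W \<times> R)"
  proof (rule bij_betw_subset [OF bij_betw_parity_word_mod_3])
    have "W \<times> R \<subseteq> ?f ` {..<?m}"
      using W R bij_betw_imp_surj_on [OF bij_betw_parity_word_mod_3, of n] by blast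
    then show "?f ` A = W \<times> R" by (fastforce simp: A_def)
  qed (auto simp: A_def)
  then have cardA: "card A = card W * card R"
    by (simp add: bij_betw_same_card card_cartesian_product)
  have "inj_on (\<lambda>a. residue_class a ?m) A"
    by (rule inj_onI) (auto simp: A_def residue_class_eq_iff cong_def)
  then have "card ?C = card W * card R"
    by (simp add: card_image cardA)
  moreover have "{s. 0 < s \<and> parity_word n s \<in> W \<and> s mod 3 \<in> R} = \<Union>?C"
  proof -
    have f_cong: "?f s = ?f a" if "[s = a] (mod ?m)" for s a
      using that cong_dvd_modulus_nat [of s a ?m "2 ^ n"] cong_dvd_modulus_nat [of s a ?m 3]
      by (simp add: parity_word_eq_iff) (simp add: cong_def)
    have "0 < s \<and> parity_word n s \<in> W \<and> s mod 3 \<in> R \<longleftrightarrow> s \<in> \<Union>?C" for s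
    proof
      assume s: "0 < s \<and> parity_word n s \<in> W \<and> s mod 3 \<in> R"
      have "[s = s mod ?m] (mod ?m)" by (simp add: cong_def)
      moreover from this have "s mod ?m \<in> A"
        using s f_cong [of s "s mod ?m"] by (simp add: A_def)
      ultimately show "s \<in> \<Union>?C" using s
        by (intro UN_I [of "s mod ?m"]) (simp_all add: residue_class_def)
    next
      assume "s \<in> \<Union>?C"
      then obtain a where "a \<in> A" "0 < s" "[s = a] (mod ?m)"
        by (auto simp: residue_class_def)
      then show "0 < s \<and> parity_word n s \<in> W \<and> s mod 3 \<in> R"
        using f_cong [of s a] by (simp add: A_def)
    qed
    then show ?thesis by blast
  qed
  ultimately show ?thesis
    unfolding union_of_residue_classes_def using fin by (intro exI [of _ ?C]) auto
qed

section \<open>Cut times as patterns in parity words\<close>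

text \<open>A window of length three slides along the word; at the first 011 nothing may remain, so
  011 occurs once, as a suffix.\<close>

fun cut_word :: "bool list \<Rightarrow> bool" where
  "cut_word (a # b # c # w) = (if \<not> a \<and> b \<and> c then w = [] else cut_word (b # c # w))"
| "cut_word _ = False"

lemma cong_3_mod_4_iff: "[n = 3] (mod 4) \<longleftrightarrow> odd n \<and> odd (collatz n)"
  for n :: nat
  unfolding cong_def collatz_def by simp presburger

lemma cong_1_mod_4_iff: "[n = 1] (mod 4) \<longleftrightarrow> odd n \<and> even (collatz n)"
  for n :: nat
  unfolding cong_def collatz_def by simp presburger

lemma one_in_cut_times_iff:
  "Suc 0 \<in> cut_times s \<longleftrightarrow> even s \<and> odd (collatz s) \<and> odd (collatz (collatz s))"
  by (auto simp: cut_times_def cong_3_mod_4_iff)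

text \<open>The shift starts at index 2: at index 1 the even iterate is \<open>s\<close> itself,
  which the orbit of \<open>collatz s\<close> does not record.\<close>

lemma Suc_Suc_in_cut_times_iff: "Suc (Suc k) \<in> cut_times s \<longleftrightarrow> Suc k \<in> cut_times (collatz s)"
  by (simp add: cut_times_def funpow_Suc_right del: funpow.simps(2))

lemma zero_notin_cut_times: "0 \<notin> cut_times s"
  by (simp add: cut_times_def)

lemma cut_time_eq_enat_iff:
  "cut_time s = enat r \<longleftrightarrow> r \<in> cut_times s \<and> (\<forall>k<r. k \<notin> cut_times s)"
proof
  assume "cut_time s = enat r"
  then show "r \<in> cut_times s \<and> (\<forall>k<r. k \<notin> cut_times s)"
    by (auto simp: cut_time_def split: if_splits intro: LeastI dest: not_less_Least)
next
  assume r: "r \<in> cut_times s \<and> (\<forall>k<r. k \<notin> cut_times s)"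
  then have "(LEAST k. k \<in> cut_times s) = r"
    by (intro Least_equality) (auto simp: not_less [symmetric])
  then show "cut_time s = enat r" using r by (auto simp: cut_time_def)
qed

lemma cut_time_eq_iff_cut_word:
  "cut_time s = enat r \<longleftrightarrow> cut_word (parity_word (Suc (Suc r)) s)"
proof (induction r arbitrary: s)
  case 0
  show ?case by (simp add: cut_time_eq_enat_iff zero_notin_cut_times)
next
  case (Suc r)
  show ?case
  \<comment> \<open>For \<open>r = 0\<close> the first window is the whole word, so a match means
    success; for larger \<open>r\<close> it means that the cut comes too early.\<close>
  proof (cases r)
    case 0
    have "cut_time s = enat (Suc r) \<longleftrightarrow> Suc 0 \<in> cut_times s"
      using 0 by (auto simp: cut_time_eq_enat_iff zero_notin_cut_times less_Suc_eq)
    then show ?thesis using 0 by (simp add: one_in_cut_times_iff)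
  next
    case (Suc q)
    have "cut_time s = enat (Suc r) \<longleftrightarrow>
        Suc 0 \<notin> cut_times s \<and> cut_time (collatz s) = enat r"
      using Suc
      by (simp add: cut_time_eq_enat_iff All_less_Suc2 zero_notin_cut_times Suc_Suc_in_cut_times_iff)
        blast
    also have "\<dots> \<longleftrightarrow> cut_word (parity_word (Suc (Suc (Suc r))) s)"
      unfolding Suc.IH one_in_cut_times_iff by (auto simp: Suc)
    finally show ?thesis .
  qed
qed

section \<open>Counting cut words\<close>

text \<open>The two letters split off are the state of the sliding window, and as initial parities
  they fix \<open>s\<close> modulo 4.\<close>

definition cut_continuations :: "bool \<Rightarrow> bool \<Rightarrow> nat \<Rightarrow> bool list set" where
  "cut_continuations a b n = {w. length w = n \<and> cut_word (a # b # w)}"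

lemma finite_cut_continuations: "finite (cut_continuations a b n)"
  by (rule finite_subset [OF _ finite_lists_length_eq [of UNIV n]])
    (auto simp: cut_continuations_def)

lemma cut_continuations_0: "cut_continuations a b 0 = {}"
  by (auto simp: cut_continuations_def)

lemma cut_continuations_Suc:
  "cut_continuations a b (Suc n) =
     (#) False ` cut_continuations b False n \<union>
     (#) True ` (if \<not> a \<and> b then {w. w = [] \<and> n = 0} else cut_continuations b True n)"
proof -
  have "w \<in> cut_continuations a b (Suc n) \<longleftrightarrow>
      w \<in> (#) False ` cut_continuations b False n \<union>
        (#) True ` (if \<not> a \<and> b then {w. w = [] \<and> n = 0} else cut_continuations b True n)"
    for w
  proof (cases w)
    case (Cons c v)
    then show ?thesis
      by (cases c) (auto simp: cut_continuations_def)
  qed (auto simp: cut_continuations_def)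
  then show ?thesis by blast
qed

lemma card_cut_continuations_Suc:
  "card (cut_continuations a b (Suc n)) =
     card (cut_continuations b False n) +
     (if \<not> a \<and> b then of_bool (n = 0) else card (cut_continuations b True n))"
proof -
  have "card (cut_continuations a b (Suc n)) =
      card (cut_continuations b False n) +
      card (if \<not> a \<and> b then {w. w = [] \<and> n = 0} else cut_continuations b True n)"
    unfolding cut_continuations_Suc
    by (subst card_Un_disjoint) (auto simp: card_image finite_cut_continuations)
  then show ?thesis by simp
qed

text \<open>A window with middle letter \<open>False\<close> never matches, so \<open>a\<close> is
  irrelevant. The next letter is \<open>False\<close>, or it is \<open>True\<close> and, unless the
  word is about to end, followed by \<open>False\<close>: the Fibonacci recurrence.\<close>

lemma card_cut_continuations_False:
  "card (cut_continuations a False (Suc n)) = fib n"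
proof (induction n arbitrary: a rule: fib.induct)
  case (3 n)
  have "card (cut_continuations a False (Suc (Suc (Suc n)))) =
      card (cut_continuations False False (Suc (Suc n))) + card (cut_continuations True False (Suc n))"
    by (simp add: card_cut_continuations_Suc [of a] card_cut_continuations_Suc [of False True])
  then show ?case by (simp add: 3)
qed (simp_all add: card_cut_continuations_Suc cut_continuations_0)

text \<open>The initial run of \<open>True\<close> either goes on or stops with a
  \<open>False\<close>, so the counts are partial sums of Fibonacci numbers; adding 1 avoids
  subtraction.\<close>

lemma card_cut_continuations_True_True:
  "card (cut_continuations True True (Suc n)) + 1 = fib (Suc n)"
proof (induction n)
  case (Suc n)
  then show ?case
    by (simp add: card_cut_continuations_Suc [of True True] card_cut_continuations_False)
qed (simp add: card_cut_continuations_Suc cut_continuations_0)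

lemma union_of_residue_classes_cut_time:
  assumes "R \<subseteq> {..<3}"
  shows "union_of_residue_classes
           {s. 0 < s \<and> odd s = a \<and> odd (collatz s) = b \<and> s mod 3 \<in> R \<and> cut_time s = enat r}
           (card (cut_continuations a b r) * card R) (12 * 2 ^ r)"
proof -
  let ?W = "(\<lambda>w. a # b # w) ` cut_continuations a b r"
  have "card ?W = card (cut_continuations a b r)"
    by (intro card_image inj_onI) simp
  moreover have "?W \<subseteq> {w. length w = Suc (Suc r)}"
    by (auto simp: cut_continuations_def)
  moreover have "parity_word (Suc (Suc r)) s \<in> ?W \<longleftrightarrow>
      odd s = a \<and> odd (collatz s) = b \<and> cut_time s = enat r" for s
    by (auto simp: cut_time_eq_iff_cut_word cut_continuations_def)
  then have "{s. 0 < s \<and> odd s = a \<and> odd (collatz s) = b \<and> s mod 3 \<in> R \<and> cut_time s = enat r} =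
      {s. 0 < s \<and> parity_word (Suc (Suc r)) s \<in> ?W \<and> s mod 3 \<in> R}"
    by blast
  \<comment> \<open>The two prefixed letters account for the factor 4 in \<open>12 * 2 ^ r\<close>,
    the residue modulo 3 for the rest.\<close>
  ultimately show ?thesis
    using union_of_residue_classes_parity_words [of ?W "Suc (Suc r)" R] assms by simp
qed

section \<open>Residues modulo 12 in terms of parities\<close>

lemma cong_12_iff: "[s = t] (mod 12) \<longleftrightarrow> [s = t] (mod 4) \<and> [s = t] (mod 3)"
  for s t :: nat
proof
  assume "[s = t] (mod 12)"
  then show "[s = t] (mod 4) \<and> [s = t] (mod 3)"
    using cong_dvd_modulus_nat [of s t 12 4] cong_dvd_modulus_nat [of s t 12 3] by simp
next
  assume "[s = t] (mod 4) \<and> [s = t] (mod 3)"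
  moreover have "coprime (4 :: nat) 3" using coprime_Suc_left_nat [of 3] by simp
  ultimately have "[s = t] (mod 4 * 3)" by (simp only: coprime_cong_mult_nat)
  then show "[s = t] (mod 12)" by simp
qed

lemma cong_9_mod_12_iff:
  "[s = 9] (mod 12) \<longleftrightarrow> odd s \<and> even (collatz s) \<and> s mod 3 = 0"
  for s :: nat
  by (simp only: cong_12_iff conj_assoc [symmetric] cong_1_mod_4_iff [symmetric]) (simp add: cong_def)

lemma cong_3_or_7_mod_12_iff:
  "[s = 3] (mod 12) \<or> [s = 7] (mod 12) \<longleftrightarrow> odd s \<and> odd (collatz s) \<and> s mod 3 \<in> {0, 1}"
  for s :: nat
  by (simp only: cong_12_iff conj_assoc [symmetric] cong_3_mod_4_iff [symmetric]) (auto simp: cong_def)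

theorem corollary4p4:
  shows "(\<forall>r::nat. r \<ge> 2 \<longrightarrow>
            union_of_residue_classes
              {s. 0 < s \<and> [s = 9] (mod 12) \<and> cut_time s = enat r}
              (fib (r - 1)) (12 * 2 ^ r)) \<and>
         (\<forall>r::nat. r \<ge> 3 \<longrightarrow>
            union_of_residue_classes
              {s. 0 < s \<and> ([s = 3] (mod 12) \<or> [s = 7] (mod 12)) \<and> cut_time s = enat r}
              (2 * fib r - 2) (12 * 2 ^ r))"
proof (intro conjI allI impI)
  fix r :: nat
  assume "r \<ge> 2"
  then obtain n where n: "r = Suc n" by (cases r) auto
  show "union_of_residue_classes
      {s. 0 < s \<and> [s = 9] (mod 12) \<and> cut_time s = enat r} (fib (r - 1)) (12 * 2 ^ r)"
    using union_of_residue_classes_cut_time [of "{0}" True False r]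
    by (simp add: cong_9_mod_12_iff n card_cut_continuations_False conj_assoc)
next
  fix r :: nat
  assume "r \<ge> 3"
  then obtain n where n: "r = Suc n" by (cases r) auto
  \<comment> \<open>The factor 2 counts the residues 0 and 1 modulo 3, coming from 3 and 7 modulo
    12.\<close>
  have "card (cut_continuations True True r) * card {0, 1 :: nat} = 2 * fib r - 2"
    unfolding n card_cut_continuations_True_True [symmetric] by simp
  then show "union_of_residue_classes
      {s. 0 < s \<and> ([s = 3] (mod 12) \<or> [s = 7] (mod 12)) \<and> cut_time s = enat r}
      (2 * fib r - 2) (12 * 2 ^ r)"
    using union_of_residue_classes_cut_time [of "{0, 1}" True True r]
    unfolding cong_3_or_7_mod_12_iff by (simp add: conj_assoc)
qed

end
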